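(* (i) If $\mathcal{S}=(S,+,\cdot,0,1)$ is a DNL-semiring then $\mathbf{S}(\mathbf{L}(\mathcal{S}))=\mathcal{S}$. (ii) If $\mathcal{L}=(L,\vee,\wedge,\odot,\rightarrow,0,1)$ is a complete residuated lattice satisfying the double negation law then $\mathbf{L}(\mathbf{S}(\mathcal{L}))=\mathcal{L}$.
   Context: A semiring is an algebra $(S,+,\cdot,0,1)$ of type $(2,2,0,0)$ such that $(S,+,0)$ is a commutative monoid, $(S,\cdot,1)$ is a monoid, $(x+y)\cdot z=x\cdot z+y\cdot z$ and $x\cdot(y+z)=x\cdot y+x\cdot z$, and $x\cdot 0=0\cdot x=0$, for all $x,y,z\in S$. It is called idempotent if $x+x=x$ for all $x$, commutative if $x\cdot y=y\cdot x$ for all $x,y$, and simple if $x+1=1$ for all $x$. If the semiring is idempotent, $(S,+)$ is a join-semilattice with induced order $a\leq b$ iff $a+b=b$, and $\sum$ over a family denotes its supremum with respect to $\leq$. A DNL-semiring is a commutative idempotent simple semiring $(S,+,\cdot,0,1)$ such that $(S,+)$ is a complete join-semilattice (every subset of $S$ has a supremum) and such that, with $n(x):=\sum_{x\cdot y=0}y$ (the supremum of $\{y\in S\mid x\cdot y=0\}$), the following hold for all $x,y\in S$: (i) $n(n(x))=x$; (ii) $x\cdot n(x\cdot n(y))\leq y$; (iii) $x\cdot n(x+y)=0$. A residuated lattice is an algebra $(L,\vee,\wedge,\odot,\rightarrow,0,1)$ of type $(2,2,2,2,0,0)$ such that $(L,\vee,\wedge,0,1)$ is a bounded lattice (with least element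 $0$ and greatest element $1$), $(L,\odot,1)$ is a commutative monoid, and for all $x,y,z\in L$: $x\odot y\leq z$ if and only if $x\leq y\rightarrow z$, where $\leq$ is the lattice order. It is complete if its lattice is complete. With $\neg x:=x\rightarrow 0$, it satisfies the double negation law if $\neg(\neg x)=x$ for all $x\in L$. For a DNL-semiring $\mathcal{S}=(S,+,\cdot,0,1)$, $\mathbf{L}(\mathcal{S}):=(S,+,\wedge,\cdot,\rightarrow,0,1)$ where $x\wedge y:=n(n(x)+n(y))$ and $x\rightarrow y:=n(x\cdot n(y))$ for all $x,y\in S$; this is a complete residuated lattice satisfying the double negation law. For a residuated lattice $\mathcal{L}=(L,\vee,\wedge,\odot,\rightarrow,0,1)$, $\mathbf{S}(\mathcal{L}):=(L,\vee,\odot,0,1)$; if $\mathcal{L}$ is complete and satisfies the double negation law, this is a DNL-semiring. Equalities in the claim are equalities of algebras (same underlying set, same operations). *)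

theory Defs
  imports "HOL-Algebra.Complete_Lattice" "HOL-Algebra.Ring"
begin

definition semiring_order :: "('a, 'b) ring_scheme \<Rightarrow> 'a gorder" where
  "semiring_order S = \<lparr>carrier = carrier S, eq = (=), le = (\<lambda>a b. a \<oplus>\<^bsub>S\<^esub> b = b)\<rparr>"

definition annihilator_sup :: "('a, 'b) ring_scheme \<Rightarrow> 'a \<Rightarrow> 'a" where
  "annihilator_sup S x =
     \<Squnion>\<^bsub>semiring_order S\<^esub> {y \<in> carrier S. x \<otimes>\<^bsub>S\<^esub> y = \<zero>\<^bsub>S\<^esub>}"

locale dnl_semiring = semiring S for S (structure) +
  assumes mult_comm: "\<lbrakk>x \<in> carrier S; y \<in> carrier S\<rbrakk> \<Longrightarrow> x \<otimes> y = y \<otimes> x"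
    and add_idem: "x \<in> carrier S \<Longrightarrow> x \<oplus> x = x"
    and simple: "x \<in> carrier S \<Longrightarrow> x \<oplus> \<one> = \<one>"
    and complete: "A \<subseteq> carrier S \<Longrightarrow>
      \<exists>s. least (semiring_order S) s (Upper (semiring_order S) A)"
    and double_neg: "x \<in> carrier S \<Longrightarrow> annihilator_sup S (annihilator_sup S x) = x"
    and mult_neg_le: "\<lbrakk>x \<in> carrier S; y \<in> carrier S\<rbrakk> \<Longrightarrow>
      x \<otimes> annihilator_sup S (x \<otimes> annihilator_sup S y) \<sqsubseteq>\<^bsub>semiring_order S\<^esub> y"
    and mult_neg_add: "\<lbrakk>x \<in> carrier S; y \<in> carrier S\<rbrakk> \<Longrightarrow>
      x \<otimes> annihilator_sup S (x \<oplus> y) = \<zero>"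

text \<open>The inherited fields \<open>mult\<close> and \<open>one\<close> are the monoid operation and its unit, which is
  also the greatest element of the lattice.\<close>

record 'a residuated_lattice = "'a monoid" +
  rl_join :: "['a, 'a] \<Rightarrow> 'a" (infixl \<open>\<curlyvee>\<index>\<close> 65)
  rl_meet :: "['a, 'a] \<Rightarrow> 'a" (infixl \<open>\<curlywedge>\<index>\<close> 70)
  rl_imp :: "['a, 'a] \<Rightarrow> 'a" (infixr \<open>\<rightharpoonup>\<index>\<close> 60)
  rl_zero :: 'a

definition lattice_order :: "('a, 'b) residuated_lattice_scheme \<Rightarrow> 'a gorder" where
  "lattice_order L = \<lparr>carrier = carrier L, eq = (=), le = (\<lambda>a b. a \<curlyvee>\<^bsub>L\<^esub> b = b)\<rparr>"

definition rl_neg :: "('a, 'b) residuated_lattice_scheme \<Rightarrow> 'a \<Rightarrow> 'a" where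
  "rl_neg L x = x \<rightharpoonup>\<^bsub>L\<^esub> rl_zero L"

locale residuated_lattice = comm_monoid L for L (structure) +
  assumes join_closed: "\<lbrakk>x \<in> carrier L; y \<in> carrier L\<rbrakk> \<Longrightarrow> x \<curlyvee> y \<in> carrier L"
    and meet_closed: "\<lbrakk>x \<in> carrier L; y \<in> carrier L\<rbrakk> \<Longrightarrow> x \<curlywedge> y \<in> carrier L"
    and imp_closed: "\<lbrakk>x \<in> carrier L; y \<in> carrier L\<rbrakk> \<Longrightarrow> x \<rightharpoonup> y \<in> carrier L"
    and zero_closed: "rl_zero L \<in> carrier L"
    and join_comm: "\<lbrakk>x \<in> carrier L; y \<in> carrier L\<rbrakk> \<Longrightarrow> x \<curlyvee> y = y \<curlyvee> x"
    and meet_comm: "\<lbrakk>x \<in> carrier L; y \<in> carrier L\<rbrakk> \<Longrightarrow> x \<curlywedge> y = y \<curlywedge> x"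
    and join_assoc: "\<lbrakk>x \<in> carrier L; y \<in> carrier L; z \<in> carrier L\<rbrakk> \<Longrightarrow>
      (x \<curlyvee> y) \<curlyvee> z = x \<curlyvee> (y \<curlyvee> z)"
    and meet_assoc: "\<lbrakk>x \<in> carrier L; y \<in> carrier L; z \<in> carrier L\<rbrakk> \<Longrightarrow>
      (x \<curlywedge> y) \<curlywedge> z = x \<curlywedge> (y \<curlywedge> z)"
    and join_absorb: "\<lbrakk>x \<in> carrier L; y \<in> carrier L\<rbrakk> \<Longrightarrow> x \<curlyvee> (x \<curlywedge> y) = x"
    and meet_absorb: "\<lbrakk>x \<in> carrier L; y \<in> carrier L\<rbrakk> \<Longrightarrow> x \<curlywedge> (x \<curlyvee> y) = x"
    and zero_least: "x \<in> carrier L \<Longrightarrow> rl_zero L \<sqsubseteq>\<^bsub>lattice_order L\<^esub> x"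
    and one_greatest: "x \<in> carrier L \<Longrightarrow> x \<sqsubseteq>\<^bsub>lattice_order L\<^esub> \<one>"
    and adjoint: "\<lbrakk>x \<in> carrier L; y \<in> carrier L; z \<in> carrier L\<rbrakk> \<Longrightarrow>
      x \<otimes> y \<sqsubseteq>\<^bsub>lattice_order L\<^esub> z \<longleftrightarrow> x \<sqsubseteq>\<^bsub>lattice_order L\<^esub> (y \<rightharpoonup> z)"

locale complete_dnl_residuated_lattice = residuated_lattice L for L (structure) +
  assumes complete: "complete_lattice (lattice_order L)"
    and double_negation: "x \<in> carrier L \<Longrightarrow> rl_neg L (rl_neg L x) = x"

definition lattice_of_semiring :: "'a ring \<Rightarrow> 'a residuated_lattice" where
  "lattice_of_semiring S =
     \<lparr>carrier = carrier S, mult = mult S, one = one S,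
      rl_join = add S,
      rl_meet = (\<lambda>x y. annihilator_sup S (annihilator_sup S x \<oplus>\<^bsub>S\<^esub> annihilator_sup S y)),
      rl_imp = (\<lambda>x y. annihilator_sup S (x \<otimes>\<^bsub>S\<^esub> annihilator_sup S y)),
      rl_zero = zero S\<rparr>"

definition semiring_of_lattice :: "'a residuated_lattice \<Rightarrow> 'a ring" where
  "semiring_of_lattice L =
     \<lparr>carrier = carrier L, mult = mult L, one = one L,
      zero = rl_zero L, add = rl_join L\<rparr>"

text \<open>Record equality would also compare the values of the operations outside the carrier, which
  are not part of the algebra. Two algebras are therefore equal when their carriers are equal,
  their constants are equal, and their operations agree on the carrier.\<close>

definition semiring_eq :: "'a ring \<Rightarrow> 'a ring \<Rightarrow> bool" where
  "semiring_eq S T \<longleftrightarrow>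
     carrier S = carrier T \<and> \<zero>\<^bsub>S\<^esub> = \<zero>\<^bsub>T\<^esub> \<and> \<one>\<^bsub>S\<^esub> = \<one>\<^bsub>T\<^esub> \<and>
     (\<forall>x\<in>carrier S. \<forall>y\<in>carrier S.
        x \<oplus>\<^bsub>S\<^esub> y = x \<oplus>\<^bsub>T\<^esub> y \<and> x \<otimes>\<^bsub>S\<^esub> y = x \<otimes>\<^bsub>T\<^esub> y)"

definition residuated_lattice_eq ::
  "'a residuated_lattice \<Rightarrow> 'a residuated_lattice \<Rightarrow> bool" where
  "residuated_lattice_eq L M \<longleftrightarrow>
     carrier L = carrier M \<and> rl_zero L = rl_zero M \<and> \<one>\<^bsub>L\<^esub> = \<one>\<^bsub>M\<^esub> \<and>
     (\<forall>x\<in>carrier L. \<forall>y\<in>carrier L.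
        x \<curlyvee>\<^bsub>L\<^esub> y = x \<curlyvee>\<^bsub>M\<^esub> y \<and> x \<curlywedge>\<^bsub>L\<^esub> y = x \<curlywedge>\<^bsub>M\<^esub> y \<and>
        x \<otimes>\<^bsub>L\<^esub> y = x \<otimes>\<^bsub>M\<^esub> y \<and> (x \<rightharpoonup>\<^bsub>L\<^esub> y) = (x \<rightharpoonup>\<^bsub>M\<^esub> y))"

end

(* The relation x \<otimes> y = 0 says y \<sqsubseteq> \<not>x, so the supremum defining n(x) is attained at \<not>x.
   Double negation makes \<not> an order-reversing involution, and comparing lower bounds then gives
   \<not>(\<not>x \<or> \<not>y) = x \<and> y and \<not>(x \<otimes> \<not>y) = x \<rightharpoonup> y. *)

theory Submission
  imports Defs
begin

context residuated_lattice
begin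

abbreviation order_le (infix \<open>\<preceq>\<close> 50) where "x \<preceq> y \<equiv> x \<sqsubseteq>\<^bsub>lattice_order L\<^esub> y"

lemma order_le_iff_join: "x \<preceq> y \<longleftrightarrow> x \<curlyvee> y = y"
  by (simp add: lattice_order_def)

text \<open>Two absorptions: \<open>x \<curlywedge> (x \<curlyvee> x) = x\<close>, and joining
  \<open>x\<close> with this meet gives \<open>x\<close> back.\<close>

lemma join_idem: "x \<in> carrier L \<Longrightarrow> x \<curlyvee> x = x"
  by (metis join_absorb meet_absorb join_closed)

lemma order_refl: "x \<in> carrier L \<Longrightarrow> x \<preceq> x"
  by (simp add: order_le_iff_join join_idem)

lemma order_antisym: "\<lbrakk>x \<preceq> y; y \<preceq> x; x \<in> carrier L; y \<in> carrier L\<rbrakk> \<Longrightarrow> x = y"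
  by (metis order_le_iff_join join_comm)

lemma partial_order_lattice_order: "partial_order (lattice_order L)"
proof
qed (auto simp: lattice_order_def join_idem join_assoc, (metis join_comm join_assoc)+)

text \<open>The order is defined through joins; absorption carries it over to meets, so that lower
  bounds can be handled.\<close>

lemma order_le_iff_meet:
  "\<lbrakk>x \<in> carrier L; y \<in> carrier L\<rbrakk> \<Longrightarrow> x \<preceq> y \<longleftrightarrow> x \<curlywedge> y = x"
  by (metis order_le_iff_join join_absorb join_comm meet_absorb meet_comm)

lemma order_le_meet_iff:
  assumes "x \<in> carrier L" "y \<in> carrier L" "z \<in> carrier L"
  shows "z \<preceq> x \<curlywedge> y \<longleftrightarrow> z \<preceq> x \<and> z \<preceq> y"
  using assms
  by (smt (verit) order_le_iff_meet meet_assoc meet_comm meet_closed join_absorb meet_absorb)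

lemma join_order_le_iff:
  assumes "x \<in> carrier L" "y \<in> carrier L" "z \<in> carrier L"
  shows "x \<curlyvee> y \<preceq> z \<longleftrightarrow> x \<preceq> z \<and> y \<preceq> z"
  using assms by (smt (verit) order_le_iff_join join_assoc join_comm join_closed join_idem)

text \<open>An element is determined by its lower set. Both identities for negation below are proved
  in this form.\<close>

lemma order_eqI:
  assumes "x \<in> carrier L" "y \<in> carrier L"
    and "\<And>z. z \<in> carrier L \<Longrightarrow> z \<preceq> x \<longleftrightarrow> z \<preceq> y"
  shows "x = y"
  using assms order_antisym order_refl by blast

lemma neg_closed: "x \<in> carrier L \<Longrightarrow> rl_neg L x \<in> carrier L"
  by (simp add: rl_neg_def imp_closed zero_closed)

lemma order_le_zero_iff: "x \<in> carrier L \<Longrightarrow> x \<preceq> rl_zero L \<longleftrightarrow> x = rl_zero L"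
  using order_antisym order_refl zero_closed zero_least by blast

text \<open>Adjointness with target \<open>rl_zero L\<close>: being below the least element means
  being equal to it.\<close>

lemma order_le_neg_iff:
  "\<lbrakk>x \<in> carrier L; y \<in> carrier L\<rbrakk> \<Longrightarrow> x \<preceq> rl_neg L y \<longleftrightarrow> x \<otimes> y = rl_zero L"
  by (simp add: rl_neg_def adjoint[symmetric] zero_closed order_le_zero_iff)

text \<open>Both sides say that the product of \<open>x\<close> and \<open>y\<close> is zero, which
  is symmetric. Thus negation forms an antitone Galois connection with itself.\<close>

lemma order_le_neg_swap:
  "\<lbrakk>x \<in> carrier L; y \<in> carrier L\<rbrakk> \<Longrightarrow> x \<preceq> rl_neg L y \<longleftrightarrow> y \<preceq> rl_neg L x"
  by (simp add: order_le_neg_iff m_comm)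

end

lemma semiring_order_semiring_of_lattice:
  "semiring_order (semiring_of_lattice L) = lattice_order L"
  by (simp add: semiring_order_def semiring_of_lattice_def lattice_order_def)

text \<open>The supremum is a Hilbert choice among least upper bounds; antisymmetry leaves only one
  candidate.\<close>

lemma (in partial_order) sup_eq_of_least:
  assumes "least L s (Upper L A)"
  shows "\<Squnion>A = s"
  unfolding sup_def using assms by (blast intro: least_unique)

lemma annihilator_sup_semiring_of_lattice:
  assumes "residuated_lattice L" and x: "x \<in> carrier L"
  shows "annihilator_sup (semiring_of_lattice L) x = rl_neg L x"
proof -
  interpret residuated_lattice L by fact
  interpret O: partial_order "lattice_order L" by (rule partial_order_lattice_order)
  let ?A = "{y \<in> carrier L. x \<otimes>\<^bsub>L\<^esub> y = rl_zero L}"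
  \<comment> \<open>Commutativity turns the annihilator of \<open>x\<close> into the principal ideal
    below \<open>rl_neg L x\<close>, whose greatest element is its supremum.\<close>
  have A: "?A = {y \<in> carrier L. y \<preceq> rl_neg L x}"
    using x by (auto simp: order_le_neg_iff m_comm)
  have "least (lattice_order L) (rl_neg L x) (Upper (lattice_order L) ?A)"
    unfolding A using x
    by (auto simp: least_def Upper_def neg_closed order_refl lattice_order_def join_idem)
  then show ?thesis
    using O.sup_eq_of_least
    by (simp add: annihilator_sup_def semiring_order_semiring_of_lattice)
      (simp add: semiring_of_lattice_def)
qed

context complete_dnl_residuated_lattice
begin

text \<open>Since \<open>y\<close> is itself a negation, that of \<open>rl_neg L y\<close>, every
  inequality becomes the vanishing of a product.\<close>

lemma order_le_iff_mult_neg: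
  assumes "x \<in> carrier L" "y \<in> carrier L"
  shows "x \<preceq> y \<longleftrightarrow> x \<otimes> rl_neg L y = rl_zero L"
  using assms order_le_neg_iff[of x "rl_neg L y"] by (simp add: double_negation neg_closed)

lemma neg_mult_neg:
  assumes x: "x \<in> carrier L" and y: "y \<in> carrier L"
  shows "rl_neg L (x \<otimes> rl_neg L y) = x \<rightharpoonup> y"
proof (rule order_eqI)
  fix z assume z: "z \<in> carrier L"
  \<comment> \<open>By adjointness on the right, both sides reduce to
    \<open>z \<otimes> x \<otimes> rl_neg L y = rl_zero L\<close>, up to associativity.\<close>
  show "z \<preceq> rl_neg L (x \<otimes> rl_neg L y) \<longleftrightarrow> z \<preceq> x \<rightharpoonup> y"
    using x y z
    by (simp add: order_le_neg_iff neg_closed adjoint[symmetric] order_le_iff_mult_neg m_assoc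
        double_negation)
qed (use x y in \<open>simp_all add: neg_closed imp_closed\<close>)

lemma neg_join_neg:
  assumes x: "x \<in> carrier L" and y: "y \<in> carrier L"
  shows "rl_neg L (rl_neg L x \<curlyvee> rl_neg L y) = x \<curlywedge> y"
proof (rule order_eqI)
  fix z assume z: "z \<in> carrier L"
  have "z \<preceq> rl_neg L (rl_neg L x \<curlyvee> rl_neg L y) \<longleftrightarrow> rl_neg L x \<curlyvee> rl_neg L y \<preceq> rl_neg L z"
    using x y z by (intro order_le_neg_swap) (simp_all add: neg_closed join_closed)
  also have "\<dots> \<longleftrightarrow> rl_neg L x \<preceq> rl_neg L z \<and> rl_neg L y \<preceq> rl_neg L z"
    using x y z by (simp add: join_order_le_iff neg_closed)
  \<comment> \<open>Swapping \<open>z \<preceq> rl_neg L (rl_neg L x)\<close> gives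
    \<open>rl_neg L x \<preceq> rl_neg L z\<close>, and double negation replaces the former by
    \<open>z \<preceq> x\<close>; likewise for \<open>y\<close>.\<close>
  also have "\<dots> \<longleftrightarrow> z \<preceq> x \<and> z \<preceq> y"
    using x y z order_le_neg_swap[of z "rl_neg L x"] order_le_neg_swap[of z "rl_neg L y"]
    by (simp add: neg_closed double_negation)
  also have "\<dots> \<longleftrightarrow> z \<preceq> x \<curlywedge> y"
    using x y z by (simp add: order_le_meet_iff)
  finally show "z \<preceq> rl_neg L (rl_neg L x \<curlyvee> rl_neg L y) \<longleftrightarrow> z \<preceq> x \<curlywedge> y" .
qed (use x y in \<open>simp_all add: neg_closed join_closed meet_closed\<close>)

end

text \<open>Passing to the lattice copies the semiring data and adds meet and implication; passing
  back forgets these two.\<close>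

lemma semiring_of_lattice_of_semiring:
  "semiring_eq (semiring_of_lattice (lattice_of_semiring S)) S"
  by (simp add: semiring_eq_def semiring_of_lattice_def lattice_of_semiring_def)

lemma lattice_of_semiring_of_lattice:
  assumes "complete_dnl_residuated_lattice L"
  shows "residuated_lattice_eq (lattice_of_semiring (semiring_of_lattice L)) L"
proof -
  interpret complete_dnl_residuated_lattice L by fact
  have n: "annihilator_sup (semiring_of_lattice L) x = rl_neg L x" if "x \<in> carrier L" for x
    using that by (intro annihilator_sup_semiring_of_lattice) unfold_locales
  have [simp]: "carrier (semiring_of_lattice L) = carrier L"
    "mult (semiring_of_lattice L) = mult L" "add (semiring_of_lattice L) = rl_join L"
    "zero (semiring_of_lattice L) = rl_zero L" "one (semiring_of_lattice L) = one L"
    by (simp_all add: semiring_of_lattice_def)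
  \<comment> \<open>Only meet and implication are recomputed. Closure lets \<open>n\<close> rewrite
    the nested annihilators too, leaving exactly \<open>neg_join_neg\<close> and
    \<open>neg_mult_neg\<close>.\<close>
  show ?thesis
    by (simp add: residuated_lattice_eq_def lattice_of_semiring_def n neg_closed join_closed
        neg_mult_neg neg_join_neg)
qed

theorem theorem16:
  fixes S :: "'a ring" and L :: "'b residuated_lattice"
  shows "(dnl_semiring S \<longrightarrow>
            semiring_eq (semiring_of_lattice (lattice_of_semiring S)) S) \<and>
         (complete_dnl_residuated_lattice L \<longrightarrow>
            residuated_lattice_eq (lattice_of_semiring (semiring_of_lattice L)) L)"
  using semiring_of_lattice_of_semiring lattice_of_semiring_of_lattice by blast

end
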